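(* There is a CNF encoding of $\mathsf{AtMostOne}(x_1,\dots,x_n)$ using $2n + 2\sqrt{2n} + \widetilde{O}(\sqrt[4]{n})$ clauses and $\sqrt{2n} + \widetilde{O}(\sqrt[4]{n})$ auxiliary variables.
   Context: $\mathsf{AtMostOne}(x_1,\dots,x_n)$ is true iff at most one of $x_1,\dots,x_n$ is true. $\widetilde{O}(g)$ denotes $O(g\cdot \log^{c} n)$ for some constant $c$. A CNF formula is a set of clauses; its size is its number of clauses. For a partial assignment $\tau$, $\varphi|_\tau$ deletes clauses satisfied by $\tau$ and literals falsified by $\tau$. A CNF $\varphi$ over $X\sqcup Y$, $X=(x_1,\dots,x_n)$, encodes $f$ if for every assignment $\tau$ of $X$, $f(\tau)=\top$ iff $\varphi|_\tau$ is satisfiable; variables in $Y$ are auxiliary. *)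

theory Defs
  imports Complex_Main "HOL-Library.Landau_Symbols"
begin

datatype 'v lit = Pos 'v | Neg 'v

fun lit_var :: "'v lit \<Rightarrow> 'v" where
  "lit_var (Pos v) = v"
| "lit_var (Neg v) = v"

type_synonym 'v clause = "'v lit set"
type_synonym 'v cnf = "'v clause set"

definition cnf_vars :: "'v cnf \<Rightarrow> 'v set" where
  "cnf_vars \<phi> = (\<Union>C\<in>\<phi>. lit_var ` C)"

fun satisfied_by :: "('v \<rightharpoonup> bool) \<Rightarrow> 'v lit \<Rightarrow> bool" where
  "satisfied_by \<tau> (Pos v) \<longleftrightarrow> \<tau> v = Some True"
| "satisfied_by \<tau> (Neg v) \<longleftrightarrow> \<tau> v = Some False"

fun falsified_by :: "('v \<rightharpoonup> bool) \<Rightarrow> 'v lit \<Rightarrow> bool" where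
  "falsified_by \<tau> (Pos v) \<longleftrightarrow> \<tau> v = Some False"
| "falsified_by \<tau> (Neg v) \<longleftrightarrow> \<tau> v = Some True"

definition restrict_cnf :: "'v cnf \<Rightarrow> ('v \<rightharpoonup> bool) \<Rightarrow> 'v cnf" where
  "restrict_cnf \<phi> \<tau> =
     (\<lambda>C. {l \<in> C. \<not> falsified_by \<tau> l}) ` {C \<in> \<phi>. \<not> (\<exists>l\<in>C. satisfied_by \<tau> l)}"

fun lit_true :: "('v \<Rightarrow> bool) \<Rightarrow> 'v lit \<Rightarrow> bool" where
  "lit_true \<alpha> (Pos v) \<longleftrightarrow> \<alpha> v"
| "lit_true \<alpha> (Neg v) \<longleftrightarrow> \<not> \<alpha> v"

definition satisfiable :: "'v cnf \<Rightarrow> bool" where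
  "satisfiable \<phi> \<longleftrightarrow> (\<exists>\<alpha>. \<forall>C\<in>\<phi>. \<exists>l\<in>C. lit_true \<alpha> l)"

text \<open>\<open>xs\<close> is the tuple of input variables, \<open>Y\<close> the set of auxiliary variables, and \<open>f\<close> a
  Boolean function taking its arguments as a list. Finiteness of \<open>\<phi>\<close> and of its clauses is not
  demanded separately, as it follows from all variables lying in the finite set
  \<open>set xs \<union> Y\<close>.\<close>

definition encodes :: "'v cnf \<Rightarrow> 'v list \<Rightarrow> 'v set \<Rightarrow> (bool list \<Rightarrow> bool) \<Rightarrow> bool" where
  "encodes \<phi> xs Y f \<longleftrightarrow>
     distinct xs \<and> finite Y \<and> set xs \<inter> Y = {} \<and> cnf_vars \<phi> \<subseteq> set xs \<union> Y \<and>
     (\<forall>\<tau>. dom \<tau> = set xs \<longrightarrow>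
        (f (map (\<lambda>x. the (\<tau> x)) xs) \<longleftrightarrow> satisfiable (restrict_cnf \<phi> \<tau>)))"

lemma encodes_imp_finite:
  assumes "encodes \<phi> xs Y f"
  shows "finite \<phi>" and "C \<in> \<phi> \<Longrightarrow> finite C"
proof -
  let ?L = "Pos ` (set xs \<union> Y) \<union> Neg ` (set xs \<union> Y)"
  have V: "lit_var l \<in> set xs \<union> Y" if "C \<in> \<phi>" "l \<in> C" for C l
    using assms that by (fastforce simp: encodes_def cnf_vars_def)
  have mem: "l \<in> ?L" if "C \<in> \<phi>" "l \<in> C" for C l
    using V[OF that] by (cases l) auto
  have fin: "finite ?L"
    using assms by (simp add: encodes_def)
  have "\<phi> \<subseteq> Pow ?L"
    using mem by blast
  then show "finite \<phi>"
    using fin by (meson finite_Pow_iff finite_subset)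
  show "finite C" if "C \<in> \<phi>"
    using mem that fin by (meson finite_subset subsetI)
qed

definition at_most_one :: "bool list \<Rightarrow> bool" where
  "at_most_one bs \<longleftrightarrow> card {i. i < length bs \<and> bs ! i} \<le> 1"

definition soft_O :: "(nat \<Rightarrow> real) \<Rightarrow> (nat \<Rightarrow> real) set" where
  "soft_O g = (\<Union>c::real. O(\<lambda>n. g n * ln (real n) powr c))"

end

theory Submission imports Defs "HOL-Library.Countable" begin

text \<open>
  Chen's product encoding lets every input imply the row and the column of a grid cell. Instead,
  label every input by an unordered pair of cells, in different rows and different columns, of a
  \<open>p \<times> p\<close> grid, and let it imply both cells; about \<open>p\<^sup>4 / 2\<close> inputs can be labelled in this
  way, so \<open>p\<^sup>2 \<approx> sqrt (2 * n)\<close> cells suffice. It remains to ensure with two clauses per cell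
  that the true cells lie among two cells. Guess rows \<open>r\<^sub>0 \<noteq> r\<^sub>1\<close> and columns \<open>s\<^sub>0 \<noteq> s\<^sub>1\<close> in unary
  and require of every true cell \<open>(r, s)\<close> that \<open>r = r\<^sub>0 \<or> s = s\<^sub>1\<close> and \<open>s = s\<^sub>0 \<or> r = r\<^sub>1\<close>: the
  mixed choices are contradictory, so the cell is \<open>(r\<^sub>0, s\<^sub>0)\<close> or \<open>(r\<^sub>1, s\<^sub>1)\<close>. Everything
  about the guesses costs only \<open>O(p)\<close>.
\<close>

section \<open>Satisfiability of a restriction, expressed by total assignments\<close>

definition models :: "('v \<Rightarrow> bool) \<Rightarrow> 'v cnf \<Rightarrow> bool" where
  "models \<beta> \<phi> \<longleftrightarrow> (\<forall>C\<in>\<phi>. \<exists>l\<in>C. lit_true \<beta> l)"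

lemma models_Un [simp]: "models \<beta> (\<phi> \<union> \<psi>) \<longleftrightarrow> models \<beta> \<phi> \<and> models \<beta> \<psi>"
  by (auto simp: models_def)

lemma models_image: "models \<beta> (f ` A) \<longleftrightarrow> (\<forall>x\<in>A. \<exists>l\<in>f x. lit_true \<beta> l)"
  by (simp add: models_def)

text \<open>A model of the restriction is overridden by \<open>\<tau>\<close> on
  \<open>dom \<tau>\<close>: surviving literals keep their truth value, and deleted clauses contain
  a literal that \<open>\<tau>\<close> satisfies. Conversely, no literal true in an extension of
  \<open>\<tau>\<close> is falsified by \<open>\<tau>\<close>, so the witness in each clause
  survives.\<close>

lemma satisfiable_restrict_cnf_iff:
  "satisfiable (restrict_cnf \<phi> \<tau>) \<longleftrightarrow> (\<exists>\<beta>. (\<forall>x\<in>dom \<tau>. \<tau> x = Some (\<beta> x)) \<and> models \<beta> \<phi>)"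
proof
  assume "satisfiable (restrict_cnf \<phi> \<tau>)"
  then obtain \<alpha> where \<alpha>: "\<And>C. C \<in> restrict_cnf \<phi> \<tau> \<Longrightarrow> \<exists>l\<in>C. lit_true \<alpha> l"
    by (auto simp: satisfiable_def)
  define \<beta> where "\<beta> x = (case \<tau> x of None \<Rightarrow> \<alpha> x | Some b \<Rightarrow> b)" for x
  have sat: "lit_true \<beta> l" if "satisfied_by \<tau> l" for l
    using that by (cases l) (auto simp: \<beta>_def)
  have free: "lit_true \<beta> l" if "lit_true \<alpha> l" "\<not> falsified_by \<tau> l" for l
    using that by (cases l) (auto simp: \<beta>_def split: option.split)
  have "\<exists>l\<in>C. lit_true \<beta> l" if "C \<in> \<phi>" for C
  proof (cases "\<exists>l\<in>C. satisfied_by \<tau> l")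
    case True
    then show ?thesis using sat by blast
  next
    case False
    then have "{l \<in> C. \<not> falsified_by \<tau> l} \<in> restrict_cnf \<phi> \<tau>"
      using that by (auto simp: restrict_cnf_def)
    from \<alpha>[OF this] show ?thesis using free by blast
  qed
  moreover have "\<forall>x\<in>dom \<tau>. \<tau> x = Some (\<beta> x)"
    by (auto simp: \<beta>_def)
  ultimately show "\<exists>\<beta>. (\<forall>x\<in>dom \<tau>. \<tau> x = Some (\<beta> x)) \<and> models \<beta> \<phi>"
    by (auto simp: models_def)
next
  assume "\<exists>\<beta>. (\<forall>x\<in>dom \<tau>. \<tau> x = Some (\<beta> x)) \<and> models \<beta> \<phi>"
  then obtain \<beta> where \<beta>: "\<And>x. x \<in> dom \<tau> \<Longrightarrow> \<tau> x = Some (\<beta> x)" "models \<beta> \<phi>"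
    by blast
  have eq: "b = \<beta> x" if "\<tau> x = Some b" for x b
    using \<beta>(1)[of x] that by auto
  have lit: "\<not> falsified_by \<tau> l" if "lit_true \<beta> l" for l
    using that eq by (cases l; force)
  have "\<exists>l\<in>C. lit_true \<beta> l" if "C \<in> restrict_cnf \<phi> \<tau>" for C
    using that \<beta>(2) lit by (fastforce simp: restrict_cnf_def models_def)
  then show "satisfiable (restrict_cnf \<phi> \<tau>)"
    by (auto simp: satisfiable_def)
qed

lemma at_most_one_map_iff:
  assumes "distinct xs"
  shows "at_most_one (map f xs) \<longleftrightarrow> (\<forall>x\<in>set xs. \<forall>y\<in>set xs. f x \<longrightarrow> f y \<longrightarrow> x = y)"
proof -
  have "{i. i < length (map f xs) \<and> map f xs ! i} = {i. i < length xs \<and> f (xs ! i)}"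
    by auto
  then have "at_most_one (map f xs) \<longleftrightarrow>
      (\<forall>i<length xs. \<forall>j<length xs. f (xs ! i) \<longrightarrow> f (xs ! j) \<longrightarrow> i = j)"
    by (auto simp: at_most_one_def card_le_Suc0_iff_eq)
  also have "\<dots> \<longleftrightarrow> (\<forall>x\<in>set xs. \<forall>y\<in>set xs. f x \<longrightarrow> f y \<longrightarrow> x = y)"
    using assms by (auto simp: all_set_conv_all_nth nth_eq_iff_index_eq)
  finally show ?thesis .
qed

text \<open>Replaces partial assignments by total ones: it remains to show that every model has at
  most one true input, and that any such choice of input values extends to a model.\<close>

lemma encodes_at_most_oneI:
  assumes "distinct xs" "finite Y" "set xs \<inter> Y = {}" "cnf_vars \<phi> \<subseteq> set xs \<union> Y"
    and sound: "\<And>\<beta> x y. models \<beta> \<phi> \<Longrightarrow> x \<in> set xs \<Longrightarrow> y \<in> set xs \<Longrightarrow> \<beta> x \<Longrightarrow> \<beta> y \<Longrightarrow> x = y"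
    and complete: "\<And>\<alpha>. \<forall>x\<in>set xs. \<forall>y\<in>set xs. \<alpha> x \<longrightarrow> \<alpha> y \<longrightarrow> x = y \<Longrightarrow>
      \<exists>\<beta>. (\<forall>x\<in>set xs. \<beta> x = \<alpha> x) \<and> models \<beta> \<phi>"
  shows "encodes \<phi> xs Y at_most_one"
proof -
  have "at_most_one (map (\<lambda>x. the (\<tau> x)) xs) \<longleftrightarrow> satisfiable (restrict_cnf \<phi> \<tau>)"
    if dom: "dom \<tau> = set xs" for \<tau> :: "'a \<rightharpoonup> bool"
  proof -
    have Some: "\<tau> x = Some (\<beta> x) \<longleftrightarrow> \<beta> x = the (\<tau> x)" if "x \<in> set xs" for \<beta> x
    proof -
      from dom that obtain t where "\<tau> x = Some t" by blast
      then show ?thesis by auto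
    qed
    have "(\<exists>\<beta>. (\<forall>x\<in>set xs. \<beta> x = the (\<tau> x)) \<and> models \<beta> \<phi>) \<longleftrightarrow>
        (\<forall>x\<in>set xs. \<forall>y\<in>set xs. the (\<tau> x) \<longrightarrow> the (\<tau> y) \<longrightarrow> x = y)"
    proof
      assume "\<exists>\<beta>. (\<forall>x\<in>set xs. \<beta> x = the (\<tau> x)) \<and> models \<beta> \<phi>"
      then obtain \<beta> where \<beta>: "\<And>x. x \<in> set xs \<Longrightarrow> \<beta> x = the (\<tau> x)" "models \<beta> \<phi>"
        by blast
      show "\<forall>x\<in>set xs. \<forall>y\<in>set xs. the (\<tau> x) \<longrightarrow> the (\<tau> y) \<longrightarrow> x = y"
        using sound[OF \<beta>(2)] \<beta>(1) by simp
    qed (rule complete)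
    then show ?thesis
      using Some assms(1) by (simp add: satisfiable_restrict_cnf_iff dom at_most_one_map_iff)
  qed
  then show ?thesis
    using assms(1-4) by (simp add: encodes_def)
qed

section \<open>Constraints on unary guesses\<close>

text \<open>Sinz' sequential encoding, where \<open>s r\<close> stands for \<open>\<exists>q\<le>r. v q\<close>.\<close>

definition chain_cnf :: "nat \<Rightarrow> (nat \<Rightarrow> 'v) \<Rightarrow> (nat \<Rightarrow> 'v) \<Rightarrow> 'v cnf" where
  "chain_cnf p v s =
     (\<lambda>r. {Neg (v r), Pos (s r)}) ` {..p} \<union>
     (\<lambda>r. {Neg (s r), Pos (s (Suc r))}) ` {..<p} \<union>
     (\<lambda>r. {Neg (s r), Neg (v (Suc r))}) ` {..<p}"

lemma models_chain_cnf_iff: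
  "models \<beta> (chain_cnf p v s) \<longleftrightarrow>
     (\<forall>r\<le>p. \<beta> (v r) \<longrightarrow> \<beta> (s r)) \<and>
     (\<forall>r<p. \<beta> (s r) \<longrightarrow> \<beta> (s (Suc r)) \<and> \<not> \<beta> (v (Suc r)))"
  by (auto simp: chain_cnf_def models_image)

lemma card_chain_cnf_le: "card (chain_cnf p v s) \<le> 3 * p + 1"
proof -
  have "card (chain_cnf p v s) \<le> card {..p} + card {..<p} + card {..<p}"
    unfolding chain_cnf_def
    by (intro card_Un_le[THEN order_trans] add_mono card_image_le) auto
  then show ?thesis by simp
qed

text \<open>A true \<open>v i\<close> makes \<open>s i\<close>, \<open>s (i + 1)\<close>, ...,
  \<open>s p\<close> true, and each \<open>s k\<close> with \<open>k < p\<close> forbids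
  \<open>v (k + 1)\<close>; hence no later \<open>v j\<close> is true.\<close>

lemma chain_cnf_at_most_one:
  assumes m: "models \<beta> (chain_cnf p v s)"
    and "i \<le> p" "j \<le> p" "\<beta> (v i)" "\<beta> (v j)"
  shows "i = j"
proof -
  have ge: "\<beta> (s k)" if "i \<le> k" "k \<le> p" "\<beta> (v i)" for i k
    using that
  proof (induction rule: dec_induct)
    case base
    then show ?case using m by (simp add: models_chain_cnf_iff)
  next
    case (step k)
    then show ?case using m by (simp add: models_chain_cnf_iff)
  qed
  have no: False if less: "i < j" and "j \<le> p" "\<beta> (v i)" "\<beta> (v j)" for i j
  proof -
    from less obtain k where "j = Suc k" "i \<le> k"
      by (auto simp: less_eq_Suc_le elim: Suc_le_D[THEN exE])
    then show False using ge[of i k] m that by (auto simp: models_chain_cnf_iff)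
  qed
  show ?thesis using no[of i j] no[of j i] assms by (meson linorder_neqE_nat)
qed

definition disjoint_cnf :: "nat \<Rightarrow> (nat \<Rightarrow> 'v) \<Rightarrow> (nat \<Rightarrow> 'v) \<Rightarrow> 'v cnf" where
  "disjoint_cnf p v w = (\<lambda>r. {Neg (v r), Neg (w r)}) ` {..<p}"

lemma models_disjoint_cnf_iff:
  "models \<beta> (disjoint_cnf p v w) \<longleftrightarrow> (\<forall>r<p. \<not> (\<beta> (v r) \<and> \<beta> (w r)))"
  by (auto simp: disjoint_cnf_def models_image)

lemma card_disjoint_cnf_le: "card (disjoint_cnf p v w) \<le> p"
  unfolding disjoint_cnf_def using card_image_le[of "{..<p}"] by fastforce

section \<open>The formula of a labelled grid\<close>

text \<open>\<open>Tick k\<close> is the unary guess of \<open>r\<^sub>0\<close>, \<open>r\<^sub>1\<close>, \<open>s\<^sub>0\<close>, \<open>s\<^sub>1\<close> for \<open>k = 0, 1, 2, 3\<close>, and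
  \<open>Chain k\<close> are the auxiliary variables of its sequential encoding.\<close>

datatype aux = Cell nat nat | Tick nat nat | Chain nat nat

instance aux :: countable
  by countable_datatype

text \<open>Input \<open>i\<close> is labelled by the cells \<open>(a i, c i)\<close> and
  \<open>(b i, d i)\<close>. Requiring \<open>b i < a i\<close> gives each unordered pair of cells
  one representative; once the rows are ordered, the columns need only differ.\<close>

locale grid_labelling =
  fixes n p :: nat and a b c d :: "nat \<Rightarrow> nat"
  assumes rows: "\<And>i. i \<in> {1..n} \<Longrightarrow> b i < a i \<and> a i < p"
    and cols: "\<And>i. i \<in> {1..n} \<Longrightarrow> c i \<noteq> d i \<and> c i < p \<and> d i < p"
    and labels_inj: "\<And>i j. \<lbrakk>i \<in> {1..n}; j \<in> {1..n}; a i = a j; b i = b j;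
        c i = c j; d i = d j\<rbrakk> \<Longrightarrow> i = j"
begin

definition var :: "aux \<Rightarrow> nat" where
  "var x = n + 1 + to_nat x"

lemma var_eq_iff [simp]: "var x = var y \<longleftrightarrow> x = y"
  by (simp add: var_def)

lemma var_gt: "n < var x"
  by (simp add: var_def)

abbreviation "cell r s \<equiv> var (Cell r s)"
abbreviation "tick k r \<equiv> var (Tick k r)"
abbreviation "chain k r \<equiv> var (Chain k r)"

definition input_cnf :: "nat cnf" where
  "input_cnf = (\<lambda>i. {Neg i, Pos (cell (a i) (c i))}) ` {1..n} \<union>
     (\<lambda>i. {Neg i, Pos (cell (b i) (d i))}) ` {1..n}"

definition cell_cnf :: "nat cnf" where
  "cell_cnf = (\<lambda>(r, s). {Neg (cell r s), Pos (tick 0 r), Pos (tick 3 s)}) ` ({..<p} \<times> {..<p}) \<union>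
     (\<lambda>(r, s). {Neg (cell r s), Pos (tick 2 s), Pos (tick 1 r)}) ` ({..<p} \<times> {..<p})"

definition guess_cnf :: "nat cnf" where
  "guess_cnf = disjoint_cnf p (tick 0) (tick 1) \<union> disjoint_cnf p (tick 2) (tick 3) \<union>
     (\<Union>k<4. chain_cnf p (tick k) (chain k))"

definition grid_cnf :: "nat cnf" where
  "grid_cnf = input_cnf \<union> cell_cnf \<union> guess_cnf"

text \<open>Ticks and chain variables run up to index \<open>p\<close> inclusive, because
  \<open>chain_cnf p\<close> mentions index \<open>p\<close>; cells stay below
  \<open>p\<close>.\<close>

definition aux_vars :: "nat set" where
  "aux_vars = var ` (case_prod Cell ` ({..<p} \<times> {..<p}) \<union>
     case_prod Tick ` ({..<4} \<times> {..p}) \<union> case_prod Chain ` ({..<4} \<times> {..p}))"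

section \<open>Correctness of the grid formula\<close>

lemma models_grid_cnf_iff:
  "models \<beta> grid_cnf \<longleftrightarrow>
     (\<forall>i\<in>{1..n}. \<beta> i \<longrightarrow> \<beta> (cell (a i) (c i)) \<and> \<beta> (cell (b i) (d i))) \<and>
     (\<forall>r<p. \<forall>s<p. \<beta> (cell r s) \<longrightarrow>
        (\<beta> (tick 0 r) \<or> \<beta> (tick 3 s)) \<and> (\<beta> (tick 2 s) \<or> \<beta> (tick 1 r))) \<and>
     (\<forall>r<p. \<not> (\<beta> (tick 0 r) \<and> \<beta> (tick 1 r))) \<and>
     (\<forall>s<p. \<not> (\<beta> (tick 2 s) \<and> \<beta> (tick 3 s))) \<and>
     (\<forall>k<4. models \<beta> (chain_cnf p (tick k) (chain k)))"
proof -
  have UN: "models \<beta> (\<Union>k<4. chain_cnf p (tick k) (chain k)) \<longleftrightarrow>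
      (\<forall>k<4. models \<beta> (chain_cnf p (tick k) (chain k)))"
    by (auto simp: models_def)
  have input: "models \<beta> input_cnf \<longleftrightarrow>
      (\<forall>i\<in>{1..n}. \<beta> i \<longrightarrow> \<beta> (cell (a i) (c i)) \<and> \<beta> (cell (b i) (d i)))"
    by (simp add: input_cnf_def models_image) blast
  have cell: "models \<beta> cell_cnf \<longleftrightarrow>
      (\<forall>r<p. \<forall>s<p. \<beta> (cell r s) \<longrightarrow>
        (\<beta> (tick 0 r) \<or> \<beta> (tick 3 s)) \<and> (\<beta> (tick 2 s) \<or> \<beta> (tick 1 r)))"
    by (simp add: cell_cnf_def models_image) blast
  show ?thesis
    unfolding grid_cnf_def guess_cnf_def models_Un UN models_disjoint_cnf_iff input cell
    by (simp only: conj_assoc)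
qed

text \<open>The label of each true input consists of exactly the two guessed cells. So the labels of
  two true inputs agree as unordered pairs, and the order of the rows makes them agree
  componentwise.\<close>

lemma grid_cnf_sound:
  assumes m: "models \<beta> grid_cnf" and ij: "i \<in> {1..n}" "j \<in> {1..n}" "\<beta> i" "\<beta> j"
  shows "i = j"
proof -
  note m' = m[unfolded models_grid_cnf_iff]
  have unique: "q = r" if "k < 4" "q < p" "r < p" "\<beta> (tick k q)" "\<beta> (tick k r)" for k q r
  proof -
    have "models \<beta> (chain_cnf p (tick k) (chain k))"
      using m' \<open>k < 4\<close> by blast
    from chain_cnf_at_most_one[OF this, of q r] that show ?thesis by simp
  qed
  have cases: "\<beta> (tick 0 r) \<and> \<beta> (tick 2 s) \<or> \<beta> (tick 1 r) \<and> \<beta> (tick 3 s)"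
    if "r < p" "s < p" "\<beta> (cell r s)" for r s
  proof -
    have "\<beta> (tick 0 r) \<or> \<beta> (tick 3 s)" "\<beta> (tick 2 s) \<or> \<beta> (tick 1 r)"
      "\<not> (\<beta> (tick 0 r) \<and> \<beta> (tick 1 r))" "\<not> (\<beta> (tick 2 s) \<and> \<beta> (tick 3 s))"
      using m' that by auto
    then show ?thesis by blast
  qed
  have cells: "\<beta> (cell (a k) (c k))" "\<beta> (cell (b k) (d k))" if "k \<in> {i, j}" for k
    using m' ij that by auto
  define fst_cell where "fst_cell r s \<longleftrightarrow> \<beta> (tick 0 r) \<and> \<beta> (tick 2 s)" for r s
  define snd_cell where "snd_cell r s \<longleftrightarrow> \<beta> (tick 1 r) \<and> \<beta> (tick 3 s)" for r s
  have fst_unique: "q = r \<and> s = t"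
    if "fst_cell q s" "fst_cell r t" "q < p" "r < p" "s < p" "t < p" for q r s t
    using that unique[of 0 q r] unique[of 2 s t] by (simp add: fst_cell_def)
  have snd_unique: "q = r \<and> s = t"
    if "snd_cell q s" "snd_cell r t" "q < p" "r < p" "s < p" "t < p" for q r s t
    using that unique[of 1 q r] unique[of 3 s t] by (simp add: snd_cell_def)
  have bounds: "b k < a k" "a k < p" "b k < p" "c k < p" "d k < p" if "k \<in> {i, j}" for k
    using rows[of k] cols[of k] ij that by auto
  \<comment> \<open>The two cells of a label lie in different rows, so they cannot both be the same
    guessed cell.\<close>
  have split: "fst_cell (a k) (c k) \<and> snd_cell (b k) (d k) \<or>
      snd_cell (a k) (c k) \<and> fst_cell (b k) (d k)" if "k \<in> {i, j}" for k
  proof -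
    note B = bounds[OF that]
    have "fst_cell (a k) (c k) \<or> snd_cell (a k) (c k)" "fst_cell (b k) (d k) \<or> snd_cell (b k) (d k)"
      using cases cells[OF that] B by (simp_all add: fst_cell_def snd_cell_def)
    moreover have "\<not> (fst_cell (a k) (c k) \<and> fst_cell (b k) (d k))"
      using fst_unique[of "a k" "c k" "b k" "d k"] B by auto
    moreover have "\<not> (snd_cell (a k) (c k) \<and> snd_cell (b k) (d k))"
      using snd_unique[of "a k" "c k" "b k" "d k"] B by auto
    ultimately show ?thesis by blast
  qed
  have I: "i \<in> {i, j}" and J: "j \<in> {i, j}" by auto
  note B = bounds[OF I] bounds[OF J]
  \<comment> \<open>In the swapped case the rows suffice: they contradict \<open>b i < a i\<close>
    and \<open>b j < a j\<close>.\<close>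
  have "a i = a j \<and> b i = b j \<and> c i = c j \<and> d i = d j \<or>
      a i = b j \<and> b i = a j"
    using split[OF I] split[OF J] B
      fst_unique[of "a i" "c i" "a j" "c j"] fst_unique[of "a i" "c i" "b j" "d j"]
      fst_unique[of "b i" "d i" "a j" "c j"] fst_unique[of "b i" "d i" "b j" "d j"]
      snd_unique[of "a i" "c i" "a j" "c j"] snd_unique[of "a i" "c i" "b j" "d j"]
      snd_unique[of "b i" "d i" "a j" "c j"] snd_unique[of "b i" "d i" "b j" "d j"]
    by (elim disjE conjE) simp_all
  then show ?thesis
    using B labels_inj[OF ij(1,2)] by auto
qed

text \<open>The guess is read off the label of the only true input. If there is none, every
  auxiliary variable is false, which is allowed because the guesses are only required to be at most
  one-hot.\<close>

lemma grid_cnf_complete: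
  assumes one: "\<forall>i\<in>{1..n}. \<forall>j\<in>{1..n}. \<alpha> i \<longrightarrow> \<alpha> j \<longrightarrow> i = j"
  shows "\<exists>\<beta>. (\<forall>i\<in>{1..n}. \<beta> i = \<alpha> i) \<and> models \<beta> grid_cnf"
proof -
  define pos where "pos k i = (if k = 0 then a i else if k = 1 then b i else if k = 2 then c i else d i)"
    for k i :: nat
  define T where "T = {i \<in> {1..n}. \<alpha> i}"
  have T: "i = j" if "i \<in> T" "j \<in> T" for i j
    using one that by (auto simp: T_def)
  have TD: "b i < a i" "c i \<noteq> d i" if "i \<in> T" for i
    using that rows cols by (auto simp: T_def)
  \<comment> \<open>Since \<open>T\<close> has at most one element, the existential quantifiers
    cover both the case of a true input and that of none.\<close>
  define val where "val x = (case x of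
      Cell r s \<Rightarrow> \<exists>i\<in>T. (r, s) = (a i, c i) \<or> (r, s) = (b i, d i)
    | Tick k r \<Rightarrow> \<exists>i\<in>T. r = pos k i
    | Chain k r \<Rightarrow> \<exists>i\<in>T. pos k i \<le> r)" for x
  define \<beta> where "\<beta> v = (if v \<le> n then \<alpha> v else val (inv var v))" for v
  have "inj var" by (rule injI) simp
  then have \<beta>_var: "\<beta> (var x) = val x" for x
    using var_gt[of x] by (simp add: \<beta>_def)
  have \<beta>_input: "\<beta> i = \<alpha> i" if "i \<in> {1..n}" for i
    using that by (simp add: \<beta>_def)
  have "models \<beta> (chain_cnf p (tick k) (chain k))" for k
  proof -
    \<comment> \<open>A chain variable records that the ticked position has been passed; as
      \<open>T\<close> has no second element, no tick can follow.\<close>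
    have "pos k j \<noteq> Suc r" if "i \<in> T" "pos k i \<le> r" "j \<in> T" for i j r
      using T[OF that(1,3)] that(2) by simp
    then show ?thesis
      by (auto simp: models_chain_cnf_iff \<beta>_var val_def intro: le_SucI) metis
  qed
  moreover have "\<beta> (cell (a i) (c i)) \<and> \<beta> (cell (b i) (d i))" if "i \<in> {1..n}" "\<beta> i" for i
    using that by (auto simp: \<beta>_var val_def T_def \<beta>_input)
  \<comment> \<open>A true cell is either \<open>(a i, c i)\<close>, with ticks 0 and 2 set, or
    \<open>(b i, d i)\<close>, with ticks 1 and 3 set; each choice meets both disjunctions.\<close>
  moreover have "(\<beta> (tick 0 r) \<or> \<beta> (tick 3 s)) \<and> (\<beta> (tick 2 s) \<or> \<beta> (tick 1 r))"
    if "\<beta> (cell r s)" for r s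
    using that by (auto simp: \<beta>_var val_def pos_def)
  moreover have "\<not> (\<beta> (tick 0 r) \<and> \<beta> (tick 1 r))" "\<not> (\<beta> (tick 2 r) \<and> \<beta> (tick 3 r))" for r
  proof -
    show "\<not> (\<beta> (tick 0 r) \<and> \<beta> (tick 1 r))"
      using T TD(1) by (simp add: \<beta>_var val_def pos_def) (metis less_irrefl)
    show "\<not> (\<beta> (tick 2 r) \<and> \<beta> (tick 3 r))"
      using T TD(2) by (simp add: \<beta>_var val_def pos_def) metis
  qed
  ultimately have "models \<beta> grid_cnf"
    unfolding models_grid_cnf_iff by blast
  with \<beta>_input show ?thesis by blast
qed

lemma cnf_vars_grid_cnf: "cnf_vars grid_cnf \<subseteq> {1..n} \<union> aux_vars"
proof -
  have cell: "cell r s \<in> aux_vars" if "r < p" "s < p" for r s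
    using that unfolding aux_vars_def by force
  have tick: "tick k r \<in> aux_vars" and chain: "chain k r \<in> aux_vars" if "k < 4" "r \<le> p" for k r
    using that unfolding aux_vars_def by force+
  have labels: "a i < p" "b i < p" "c i < p" "d i < p" if "i \<in> {1..n}" for i
    using rows[OF that] cols[OF that] by auto
  show ?thesis
    using labels
    by (auto simp: cnf_vars_def grid_cnf_def input_cnf_def cell_cnf_def guess_cnf_def
        disjoint_cnf_def chain_cnf_def intro!: cell tick chain)
qed

lemma encodes_grid_cnf: "encodes grid_cnf [1..<Suc n] aux_vars at_most_one"
proof (rule encodes_at_most_oneI)
  have set: "set [1..<Suc n] = {1..n}" by auto
  show "set [1..<Suc n] \<inter> aux_vars = {}"
    unfolding set using var_gt by (fastforce simp: aux_vars_def dest: leD)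
  show "cnf_vars grid_cnf \<subseteq> set [1..<Suc n] \<union> aux_vars"
    unfolding set by (rule cnf_vars_grid_cnf)
  show "i = j" if "models \<beta> grid_cnf" "i \<in> set [1..<Suc n]" "j \<in> set [1..<Suc n]" "\<beta> i" "\<beta> j"
    for \<beta> i j
    using that unfolding set by (rule grid_cnf_sound)
  show "\<exists>\<beta>. (\<forall>i\<in>set [1..<Suc n]. \<beta> i = \<alpha> i) \<and> models \<beta> grid_cnf"
    if "\<forall>i\<in>set [1..<Suc n]. \<forall>j\<in>set [1..<Suc n]. \<alpha> i \<longrightarrow> \<alpha> j \<longrightarrow> i = j" for \<alpha>
    using that unfolding set by (rule grid_cnf_complete)
qed (auto simp: aux_vars_def)

section \<open>Counting variables and clauses\<close>

lemma card_aux_vars: "card aux_vars = p\<^sup>2 + 8 * (p + 1)"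
proof -
  have inj: "inj_on (case_prod Cell) A" "inj_on (case_prod Tick) A" "inj_on (case_prod Chain) A" for A
    by (auto simp: inj_on_def)
  have "inj_on var A" for A by (auto simp: inj_on_def)
  then have "card aux_vars = card (case_prod Cell ` ({..<p} \<times> {..<p}) \<union>
     case_prod Tick ` ({..<4} \<times> {..p}) \<union> case_prod Chain ` ({..<4} \<times> {..p}))"
    unfolding aux_vars_def by (rule card_image)
  also have "\<dots> = card (case_prod Cell ` ({..<p} \<times> {..<p})) +
     card (case_prod Tick ` ({..<4::nat} \<times> {..p})) + card (case_prod Chain ` ({..<4::nat} \<times> {..p}))"
    by (subst card_Un_disjoint, auto)+
  also have "\<dots> = p\<^sup>2 + 8 * (p + 1)"
    by (simp add: card_image inj power2_eq_square)
  finally show ?thesis .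
qed

text \<open>The count is exact because the error term is bounded in absolute value. The literal
  \<open>Neg i\<close> identifies the input, and \<open>b i < a i\<close> keeps its two clauses
  apart.\<close>

lemma card_input_cnf: "card input_cnf = 2 * n"
proof -
  have "card input_cnf = card ((\<lambda>i. {Neg i, Pos (cell (a i) (c i))}) ` {1..n}) +
      card ((\<lambda>i. {Neg i, Pos (cell (b i) (d i))}) ` {1..n})"
    unfolding input_cnf_def
  proof (rule card_Un_disjoint)
    show "(\<lambda>i. {Neg i, Pos (cell (a i) (c i))}) ` {1..n} \<inter>
        (\<lambda>i. {Neg i, Pos (cell (b i) (d i))}) ` {1..n} = {}"
      using rows by (fastforce simp: doubleton_eq_iff)
  qed auto
  also have "\<dots> = card {1..n} + card {1..n}"
    by (intro arg_cong2[where f = "(+)"] card_image) (auto simp: inj_on_def doubleton_eq_iff)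
  finally show ?thesis by simp
qed

text \<open>The only negative literal identifies the cell, and a tick of kind 0 occurs only in the
  first family of clauses.\<close>

lemma card_cell_cnf: "card cell_cnf = 2 * p\<^sup>2"
proof -
  have neg: "r = q \<and> s = t"
    if "{Neg (cell r s), Pos u, Pos v} = {Neg (cell q t), Pos u', Pos v'}" for q r s t u v u' v'
  proof -
    from that have "Neg (cell r s) \<in> {Neg (cell q t), Pos u', Pos v'}" by blast
    then show ?thesis by simp
  qed
  have "card cell_cnf =
      card ((\<lambda>(r, s). {Neg (cell r s), Pos (tick 0 r), Pos (tick 3 s)}) ` ({..<p} \<times> {..<p})) +
      card ((\<lambda>(r, s). {Neg (cell r s), Pos (tick 2 s), Pos (tick 1 r)}) ` ({..<p} \<times> {..<p}))"
    unfolding cell_cnf_def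
  proof (rule card_Un_disjoint)
    have "{Neg (cell r s), Pos (tick 0 r), Pos (tick 3 s)} \<noteq>
        {Neg (cell q t), Pos (tick 2 t), Pos (tick 1 q)}" for q r s t
    proof -
      have "Pos (tick 0 r) \<notin> {Neg (cell q t), Pos (tick 2 t), Pos (tick 1 q)}"
        by simp
      then show ?thesis by blast
    qed
    then show "(\<lambda>(r, s). {Neg (cell r s), Pos (tick 0 r), Pos (tick 3 s)}) ` ({..<p} \<times> {..<p}) \<inter>
        (\<lambda>(r, s). {Neg (cell r s), Pos (tick 2 s), Pos (tick 1 r)}) ` ({..<p} \<times> {..<p}) = {}"
      by auto
  qed auto
  also have "\<dots> = card ({..<p} \<times> {..<p}) + card ({..<p} \<times> {..<p})"
    by (intro arg_cong2[where f = "(+)"] card_image) (auto simp: inj_on_def dest!: neg)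
  finally show ?thesis by (simp add: power2_eq_square)
qed

lemma input_cell_disjoint: "input_cnf \<inter> cell_cnf = {}"
proof -
  have "\<exists>i\<le>n. Neg i \<in> C" if "C \<in> input_cnf" for C
    using that by (auto simp: input_cnf_def)
  moreover have "\<not> (\<exists>i\<le>n. Neg i \<in> C)" if "C \<in> cell_cnf" for C
    using that var_gt by (auto simp: cell_cnf_def not_le)
  ultimately show ?thesis by blast
qed

lemma finite_grid_cnf: "finite grid_cnf"
  using encodes_grid_cnf by (rule encodes_imp_finite)

text \<open>Two disjointness constraints cost \<open>2 * p\<close> and four chains cost
  \<open>4 * (3 * p + 1)\<close>. An upper bound is enough for this lower-order part.\<close>

lemma card_guess_cnf_le: "card guess_cnf \<le> 14 * p + 4"
proof -
  have "card (\<Union>k<4::nat. chain_cnf p (tick k) (chain k)) \<le>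
      (\<Sum>k<4::nat. card (chain_cnf p (tick k) (chain k)))"
    by (rule card_UN_le) simp
  also have "\<dots> \<le> (\<Sum>k<4::nat. 3 * p + 1)"
    by (intro sum_mono card_chain_cnf_le)
  finally have "card (\<Union>k<4::nat. chain_cnf p (tick k) (chain k)) \<le> 12 * p + 4"
    by simp
  then have "card guess_cnf \<le> (p + p) + (12 * p + 4)"
    unfolding guess_cnf_def
    by (intro card_Un_le[THEN order_trans] add_mono card_disjoint_cnf_le)
  then show ?thesis by simp
qed

lemma card_grid_cnf_bounds:
  "2 * n + 2 * p\<^sup>2 \<le> card grid_cnf" "card grid_cnf \<le> 2 * n + 2 * p\<^sup>2 + 14 * p + 4"
proof -
  have "finite (input_cnf \<union> cell_cnf)"
    using finite_grid_cnf by (simp add: grid_cnf_def)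
  then have *: "card (input_cnf \<union> cell_cnf) = 2 * n + 2 * p\<^sup>2"
    using input_cell_disjoint by (simp add: card_Un_disjoint card_input_cnf card_cell_cnf)
  show "2 * n + 2 * p\<^sup>2 \<le> card grid_cnf"
    unfolding *[symmetric] using finite_grid_cnf by (rule card_mono) (auto simp: grid_cnf_def)
  have "card grid_cnf \<le> card (input_cnf \<union> cell_cnf) + card guess_cnf"
    unfolding grid_cnf_def by (rule card_Un_le)
  then show "card grid_cnf \<le> 2 * n + 2 * p\<^sup>2 + 14 * p + 4"
    using * card_guess_cnf_le by linarith
qed

end

section \<open>Existence of enough labels\<close>

lemma grid_labelling_exists:
  assumes "2 * n \<le> (p * (p - 1))\<^sup>2"
  shows "\<exists>a b c d. grid_labelling n p a b c d"
proof -
  \<comment> \<open>Unordered pairs of rows are stored as decreasing pairs in \<open>R\<close>,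
    while \<open>S\<close> holds ordered pairs of distinct columns. This gives
    \<open>(p * (p - 1))\<^sup>2 / 2\<close> labels, and any injection into them will do.\<close>
  define R where "R = (SIGMA a:{..<p}. {..<a})"
  define S where "S = (SIGMA c:{..<p}. {..<p} - {c})"
  have "2 * (\<Sum>a<p. a) = p * (p - 1)"
    by (induction p) (auto simp: algebra_simps)
  then have R: "2 * card R = p * (p - 1)" by (simp add: R_def)
  have S: "card S = p * (p - 1)"
    by (simp add: S_def)
  have "2 * card {1..n} \<le> 2 * card R * card S"
    using assms unfolding R S by (simp add: power2_eq_square)
  then have "card {1..n} \<le> card (R \<times> S)"
    by (simp add: card_cartesian_product)
  moreover have "finite (R \<times> S)" by (simp add: R_def S_def)
  ultimately obtain g where g: "g ` {1..n} \<subseteq> R \<times> S" "inj_on g {1..n}"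
    using card_le_inj[of "{1..n}" "R \<times> S"] by auto
  have mem: "g i \<in> R \<times> S" if "i \<in> {1..n}" for i
    using g(1) that by blast
  have "grid_labelling n p (\<lambda>i. fst (fst (g i))) (\<lambda>i. snd (fst (g i)))
      (\<lambda>i. fst (snd (g i))) (\<lambda>i. snd (snd (g i)))"
  proof
    fix i assume "i \<in> {1..n}"
    from mem[OF this] show "snd (fst (g i)) < fst (fst (g i)) \<and> fst (fst (g i)) < p"
      and "fst (snd (g i)) \<noteq> snd (snd (g i)) \<and> fst (snd (g i)) < p \<and> snd (snd (g i)) < p"
      by (auto simp: R_def S_def)
  next
    fix i j assume ij: "i \<in> {1..n}" "j \<in> {1..n}"
      and "fst (fst (g i)) = fst (fst (g j))" "snd (fst (g i)) = snd (fst (g j))"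
        "fst (snd (g i)) = fst (snd (g j))" "snd (snd (g i)) = snd (snd (g j))"
    then have "g i = g j" by (simp add: prod_eq_iff)
    with g(2) ij show "i = j" by (simp add: inj_onD)
  qed
  then show ?thesis by blast
qed

lemma at_most_one_encoding:
  assumes "2 * n \<le> (p * (p - 1))\<^sup>2"
  shows "\<exists>\<phi> Y. encodes \<phi> [1..<Suc n] Y at_most_one \<and> card Y = p\<^sup>2 + 8 * (p + 1) \<and>
    2 * n + 2 * p\<^sup>2 \<le> card \<phi> \<and> card \<phi> \<le> 2 * n + 2 * p\<^sup>2 + 14 * p + 4"
proof -
  from grid_labelling_exists[OF assms] obtain a b c d where "grid_labelling n p a b c d"
    by blast
  then interpret grid_labelling n p a b c d .
  show ?thesis
    using encodes_grid_cnf card_aux_vars card_grid_cnf_bounds by blast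
qed

section \<open>Choice of the grid size and asymptotics\<close>

definition grid_size :: "nat \<Rightarrow> nat" where
  "grid_size n = nat \<lceil>root 4 (2 * real n)\<rceil> + 1"

lemma grid_size_bounds:
  fixes n :: nat
  defines "u \<equiv> root 4 (2 * real n)"
  shows "u + 1 \<le> real (grid_size n)" "real (grid_size n) \<le> u + 2"
proof -
  have "u \<ge> 0" by (simp add: u_def)
  then have "real (nat \<lceil>u\<rceil>) = of_int \<lceil>u\<rceil>" by simp
  then show "u + 1 \<le> real (grid_size n)" "real (grid_size n) \<le> u + 2"
    unfolding grid_size_def u_def by linarith+
qed

lemma root4_power2: "0 \<le> x \<Longrightarrow> (root 4 x)\<^sup>2 = sqrt x"
proof -
  assume "0 \<le> x"
  then have "((root 4 x)\<^sup>2)\<^sup>2 = x"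
    by (simp flip: power_mult)
  then show ?thesis by (metis real_sqrt_unique zero_le_power2)
qed

text \<open>The summand 1 in \<open>grid_size\<close> ensures that
  \<open>q = grid_size n - 1\<close> is still at least the fourth root \<open>u\<close> of
  \<open>2 * n\<close>, so the right-hand side is at least \<open>q ^ 4\<close>, hence at least
  \<open>u ^ 4 = 2 * n\<close>.\<close>

lemma grid_size_sufficient: "2 * n \<le> (grid_size n * (grid_size n - 1))\<^sup>2"
proof -
  define u where "u = root 4 (2 * real n)"
  define q where "q = grid_size n - 1"
  have p: "grid_size n = q + 1" by (simp add: q_def grid_size_def)
  have "0 \<le> u" "u \<le> real q"
    using grid_size_bounds(1)[of n] by (simp_all add: u_def p)
  then have "u ^ 4 \<le> real q ^ 4" by (intro power_mono)
  also have "\<dots> \<le> ((real q + 1) * real q)\<^sup>2"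
  proof -
    have "(real q)\<^sup>2 \<le> (real q + 1) * real q"
      by (simp add: power2_eq_square algebra_simps)
    then have "((real q)\<^sup>2)\<^sup>2 \<le> ((real q + 1) * real q)\<^sup>2"
      by (intro power_mono) auto
    then show ?thesis by (simp flip: power_mult)
  qed
  finally have "real (2 * n) \<le> real (((q + 1) * q)\<^sup>2)"
    by (simp add: u_def algebra_simps)
  then show ?thesis unfolding p of_nat_le_iff by simp
qed

text \<open>The side \<open>p\<close> of the grid lies between \<open>u\<close> and
  \<open>u + 2\<close>, where \<open>u\<^sup>2 = sqrt (2 * n)\<close>; squaring leaves an excess of
  at most \<open>4 * u + 4\<close>, of fourth-root order.\<close>

lemma grid_size_power2_bounds:
  "sqrt (2 * real n) \<le> (real (grid_size n))\<^sup>2"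
  "(real (grid_size n))\<^sup>2 \<le> sqrt (2 * real n) + 4 * root 4 (2 * real n) + 4"
proof -
  define u where "u = root 4 (2 * real n)"
  have u: "0 \<le> u" "u\<^sup>2 = sqrt (2 * real n)"
    by (simp_all add: u_def root4_power2)
  have b: "u \<le> real (grid_size n)" "real (grid_size n) \<le> u + 2"
    using grid_size_bounds[of n] by (simp_all add: u_def)
  show "sqrt (2 * real n) \<le> (real (grid_size n))\<^sup>2"
    using power_mono[OF b(1) u(1), of 2] u by simp
  have "(real (grid_size n))\<^sup>2 \<le> (u + 2)\<^sup>2"
    using b(2) by (intro power_mono) auto
  also have "\<dots> = sqrt (2 * real n) + 4 * u + 4"
    using u by (simp add: power2_eq_square algebra_simps)
  finally show "(real (grid_size n))\<^sup>2 \<le> sqrt (2 * real n) + 4 * root 4 (2 * real n) + 4"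
    by (simp add: u_def)
qed

text \<open>The exponent \<open>c = 0\<close> works: the error is bounded by the fourth root without
  any logarithmic factor.\<close>

lemma soft_O_root4I:
  assumes "\<And>n. \<bar>f n\<bar> \<le> A * root 4 (2 * real n) + A" "0 \<le> A"
  shows "f \<in> soft_O (\<lambda>n. root 4 (real n))"
proof -
  \<comment> \<open>At \<open>n = 1\<close> the logarithm vanishes and \<open>0 powr 0 = 0\<close>,
    so the bound starts at 2. The factor 3 comes from
    \<open>root 4 (2 * n) \<le> 2 * root 4 n\<close> and \<open>1 \<le> root 4 n\<close>.\<close>
  have "norm (f n) \<le> (3 * A) * norm (root 4 (real n) * ln (real n) powr 0)" if "n \<ge> 2" for n
  proof -
    have "root 4 2 \<le> root 4 (2 ^ 4 :: real)" by (subst real_root_le_iff) auto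
    then have "root 4 (2 :: real) \<le> 2" by (subst (asm) real_root_power_cancel) auto
    then have "root 4 (2 * real n) \<le> 2 * root 4 (real n)"
      by (simp add: real_root_mult mult_right_mono)
    moreover have "1 \<le> root 4 (real n)" using that by simp
    ultimately have "A * root 4 (2 * real n) + A * 1 \<le> A * (2 * root 4 (real n)) + A * root 4 (real n)"
      using assms(2) by (intro add_mono mult_left_mono) auto
    also have "\<dots> = (3 * A) * root 4 (real n)" by (simp add: algebra_simps)
    finally show ?thesis using assms(1)[of n] that by simp
  qed
  then have "f \<in> O(\<lambda>n. root 4 (real n) * ln (real n) powr 0)"
    by (intro bigoI eventually_sequentiallyI)
  then show ?thesis unfolding soft_O_def by blast
qed

theorem theorem8:
  "\<exists>(\<phi> :: nat \<Rightarrow> nat cnf) (Y :: nat \<Rightarrow> nat set).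
     (\<forall>n. encodes (\<phi> n) [1..<Suc n] (Y n) at_most_one) \<and>
     (\<lambda>n. real (card (\<phi> n)) - (2 * real n + 2 * sqrt (2 * real n)))
       \<in> soft_O (\<lambda>n. root 4 (real n)) \<and>
     (\<lambda>n. real (card (Y n)) - sqrt (2 * real n))
       \<in> soft_O (\<lambda>n. root 4 (real n))"
proof -
  obtain \<phi> :: "nat \<Rightarrow> nat cnf" and Y :: "nat \<Rightarrow> nat set" where enc:
    "\<And>n. encodes (\<phi> n) [1..<Suc n] (Y n) at_most_one"
    "\<And>n. card (Y n) = (grid_size n)\<^sup>2 + 8 * (grid_size n + 1)"
    "\<And>n. 2 * n + 2 * (grid_size n)\<^sup>2 \<le> card (\<phi> n)"
    "\<And>n. card (\<phi> n) \<le> 2 * n + 2 * (grid_size n)\<^sup>2 + 14 * grid_size n + 4"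
    using at_most_one_encoding[OF grid_size_sufficient] by metis
  have "(\<lambda>n. real (card (\<phi> n)) - (2 * real n + 2 * sqrt (2 * real n)))
      \<in> soft_O (\<lambda>n. root 4 (real n))"
  proof (rule soft_O_root4I)
    fix n
    have "real (2 * n + 2 * (grid_size n)\<^sup>2) \<le> real (card (\<phi> n))"
      "real (card (\<phi> n)) \<le> real (2 * n + 2 * (grid_size n)\<^sup>2 + 14 * grid_size n + 4)"
      using enc(3,4) by (simp_all only: of_nat_le_iff)
    moreover have "0 \<le> root 4 (2 * real n)" by simp
    \<comment> \<open>With \<open>u\<close> the fourth root of \<open>2 * n\<close>, the excess is
      at most \<open>2 * (4 * u + 4) + 14 * (u + 2) + 4 = 22 * u + 40\<close>.\<close>
    ultimately show "\<bar>real (card (\<phi> n)) - (2 * real n + 2 * sqrt (2 * real n))\<bar>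
        \<le> 40 * root 4 (2 * real n) + 40"
      using grid_size_power2_bounds[of n] grid_size_bounds[of n]
      unfolding of_nat_add of_nat_mult of_nat_power of_nat_numeral by linarith
  qed simp
  moreover have "(\<lambda>n. real (card (Y n)) - sqrt (2 * real n)) \<in> soft_O (\<lambda>n. root 4 (real n))"
  proof (rule soft_O_root4I)
    fix n
    have "real (card (Y n)) = (real (grid_size n))\<^sup>2 + 8 * real (grid_size n) + 8"
      by (simp add: enc(2))
    moreover have "0 \<le> root 4 (2 * real n)" by simp
    \<comment> \<open>Here the excess is at most
      \<open>(4 * u + 4) + 8 * (u + 2) + 8 = 12 * u + 28\<close>, so the same constant
      serves.\<close>
    ultimately show "\<bar>real (card (Y n)) - sqrt (2 * real n)\<bar> \<le> 40 * root 4 (2 * real n) + 40"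
      using grid_size_power2_bounds[of n] grid_size_bounds[of n] unfolding abs_le_iff by (intro conjI) linarith+
  qed simp
  ultimately show ?thesis using enc(1) by blast
qed

end
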